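(* Let $(S,S_0,\mathbf{P},\{\mathit{fail}\},L)$ be the RL execution model (a discrete-time Markov process) determined by a state space $S\subseteq\mathbb{R}^n$, a finite action set $A$, an environment $E:S\times A\to S$, a probabilistic policy $\pi:S\to \mathit{Dist}(A)$, initial states $S_0\subseteq S$ and failure states $S_{\mathit{fail}}\subseteq S$. Let $\hat S\subseteq\mathcal{P}(S)$ be a set of abstract states, $\hat E$ an environment abstraction of $E$, $(\hat\pi_L,\hat\pi_U)$ a policy abstraction of $\pi$, and let the interval Markov decision process $(\hat S,\hat S_0,\hat{\mathbf{P}},\{\mathit{fail}\},\hat L)$ be a corresponding RL execution abstraction. Let $k\in\mathbb{N}$. Then for every state $s\in S$ and every abstract state $\hat s\in\hat S$ with $s\in\hat s$, $$ \mathit{Pr}_{s}(\Diamond^{\leq k}\mathit{fail})\ \leq\ \mathit{Pr}_{\hat s}^{\max\max}(\Diamond^{\leq k}\mathit{fail}). $$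
   Context: Notation. $\mathit{Dist}(X)$ is the set of discrete probability distributions on $X$; $\mathrm{supp}(\mu)=\{x : \mu(x)>0\}$; $\mathcal{P}(X)$ is the powerset of $X$; $\mathbb{N}$ includes $0$. We write $\pi(s,a)$ or $\pi(s)(a)$ for the probability that the policy $\pi$ chooses $a$ in $s$. Discrete-time Markov process (DTMP, finite-branching). A tuple $(S,S_0,\mathbf{P},AP,L)$ with $S$ a possibly uncountable set of states, $S_0\subseteq S$ initial states, $\mathbf{P}:S\times S\to[0,1]$ such that each $\mathbf{P}(s,\cdot)$ has finite support and $\sum_{s'\in\mathrm{supp}(\mathbf{P}(s,\cdot))}\mathbf{P}(s,s')=1$, $AP$ a set of atomic propositions, and $L:S\to\mathcal{P}(AP)$ a labelling. Write $s\models b$ if $b\in L(s)$. $\mathit{Pr}_s$ is the usual probability measure on infinite paths $s_0s_1s_2\dots$ starting in $s_0=s$ (with $\mathbf{P}(s_i,s_{i+1})>0$ for all $i$), and $\mathit{Pr}_s(\Diamond^{\leq k} b)=\mathit{Pr}_s(\{s_0s_1\dots : s_i\models b\text{ for some }0\leq i\leq k\})$. Equivalently, it equals $1$ if $s\models b$; $0$ if $s\not\models b$ and $k=0$; and $\sum_{s'\in\mathrm{supp}(\mathbf{P}(s,\cdot))}\mathbf{P}(s,s')\cdot \mathit{Pr}_{s'}(\Diamond^{\leq k-1}b)$ otherwise. RL execution model. Given $S\subseteq\mathbb{R}^n$, finite $A$, $E:S\times A\to S$, $\pi:S\to\mathit{Dist}(A)$, $S_0,S_{\mathit{fail}}\subseteq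 S$, it is the DTMP $(S,S_0,\mathbf{P},AP,L)$ with $AP=\{\mathit{fail}\}$, $\mathit{fail}\in L(s)$ iff $s\in S_{\mathit{fail}}$, and $\mathbf{P}(s,s')=\sum\{\pi(s)(a) \mid a\in A,\ E(s,a)=s'\}$ (a sum over actions $a$). Interval Markov decision process (IMDP). A tuple $(S,S_0,\mathbf{P},AP,L)$ with $S$ a finite set of states, $S_0\subseteq S$ initial states, $\mathbf{P}:S\times\mathbb{N}\times S\to\mathbb{I}\cup\{0\}$ where $\mathbb{I}=\{[a,b] : 0<a\leq b\leq 1\}$ (each transition gets a probability interval or the probability exactly $0$; $[0,0]$ is identified with $0$), $AP$ a set of atomic propositions and $L:S\to\mathcal{P}(AP)$. In each state $s$ an action, given by an index $j\in\mathbb{N}$ available in $s$, is chosen; the probability of moving to each $s'$ then lies in $\mathbf{P}(s,j,s')$. A policy $\sigma$ selects an available index $j$ in the current state, based on the history of the execution so far. An environment policy $\tau$ selects, given the history so far and the chosen index $j$ in the current state $s$, a probability distribution over successors $s'$ whose values lie in the intervals $\mathbf{P}(s,j,s')$ (and are $0$ where $\mathbf{P}(s,j,s')=0$). Each pair $(\sigma,\tau)$ induces a probability measure $\mathit{Pr}_s^{\sigma,\tau}$ on infinite paths from $s$; $\mathit{Pr}_s^{\sigma,\tau}(\Diamond^{\leq k}b)$ is the probability that one of the first $k+1$ states (positions $0,\dots,k$) of the path is labelled $b$. Define $$\mathit{Pr}_s^{\max\max}(\Diamond^{\leq k}b)=\sup_\sigma\sup_\tau \mathit{Pr}_s^{\sigma,\tau}(\Diamond^{\leq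 k}b).$$ Environment abstraction. For a set of abstract states $\hat S\subseteq\mathcal{P}(S)$ (nonempty subsets of $S$), a function $\hat E:\hat S\times A\to\hat S$ such that $E(s,a)\in\hat E(\hat s,a)$ for all $\hat s\in\hat S$, $s\in\hat s$, $a\in A$. Policy abstraction. A pair of functions $\hat\pi_L,\hat\pi_U:\hat S\times A\to[0,1]$ with $\hat\pi_L(\hat s,a)\leq\pi(s,a)\leq\hat\pi_U(\hat s,a)$ for all $\hat s\in\hat S$, $s\in\hat s$, $a\in A$. RL execution abstraction. Given an environment $E:S\times A\to S$ and a policy $\pi:S\to\mathit{Dist}(A)$, the RL execution model DTMP $(S,S_0,\mathbf{P},AP,L)$ determined by $S$, $A$, $E$, $\pi$, $S_0$ and $S_{\mathit{fail}}$, a set of abstract states $\hat S\subseteq\mathcal{P}(S)$, an environment abstraction $\hat E:\hat S\times A\to\hat S$ of $E$ and a policy abstraction $(\hat\pi_L,\hat\pi_U)$ of $\pi$, an RL execution abstraction is an IMDP $(\hat S,\hat S_0,\hat{\mathbf{P}},AP,\hat L)$ such that: (1) for all $s\in S_0$ there is $\hat s\in\hat S_0$ with $s\in\hat s$; (2) for each $\hat s\in\hat S$ there is a partition $\{\hat s_1,\dots,\hat s_m\}$ of $\hat s$ into abstract states $\hat s_j\in\hat S$ ($m$ depending on $\hat s$) such that the indices available in $\hat s$ are exactly $j\in\{1,\dots,m\}$ and, for each such $j$ and each $\hat s'\in\hat S$, $\hat{\mathbf{P}}(\hat s,j,\hat s')=[\hat{\mathbf{P}}_L(\hat s,j,\hat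 s'),\hat{\mathbf{P}}_U(\hat s,j,\hat s')]$, where $$\hat{\mathbf{P}}_L(\hat s,j,\hat s')=\sum\{\hat\pi_L(\hat s_j,a)\mid a\in A,\ \hat E(\hat s_j,a)=\hat s'\},\qquad \hat{\mathbf{P}}_U(\hat s,j,\hat s')=\sum\{\hat\pi_U(\hat s_j,a)\mid a\in A,\ \hat E(\hat s_j,a)=\hat s'\};$$ (3) $AP=\{\mathit{fail}\}$, and $\mathit{fail}\in\hat L(\hat s)$ iff $\mathit{fail}\in L(s)$ for some $s\in\hat s$. *)

theory Defs
  imports "HOL-Probability.Probability"
begin

section \<open>Measures on infinite paths\<close>

text \<open>
  A random sequence over the set \<open>X\<close> whose next element, after the finite sequence \<open>h\<close>, is \<open>x\<close> with
  probability \<open>p h x\<close>. The one-step kernels are the discrete measures \<open>point_measure X (p h)\<close>; the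
  measure on infinite sequences is their Ionescu-Tulcea projective limit, on the sigma-algebra
  generated by the cylinder sets. (Outside its locale, the library constant has to be written with
  its parameters.) The limit is meaningful only if the locale assumptions hold; this is shown below
  for the two kinds of processes used here. The sample space consists of all sequences over \<open>X\<close>;
  cylinders containing a step of probability \<open>0\<close> have measure \<open>0\<close>.
\<close>

definition path_kernel :: "'x set \<Rightarrow> ('x list \<Rightarrow> 'x \<Rightarrow> real) \<Rightarrow> nat \<Rightarrow> (nat \<Rightarrow> 'x) \<Rightarrow> 'x measure" where
  "path_kernel X p = (\<lambda>i \<omega>. point_measure X (\<lambda>x. ennreal (p (map \<omega> [0..<i]) x)))"

definition path_measure :: "'x set \<Rightarrow> ('x list \<Rightarrow> 'x \<Rightarrow> real) \<Rightarrow> (nat \<Rightarrow> 'x) measure" where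
  "path_measure X p =
     projective_family.lim UNIV
       (Ionescu_Tulcea.CI (path_kernel X p) (\<lambda>_. count_space X)) (\<lambda>_. count_space X)"

record ('s, 'p) labelled_states =
  states :: "'s set"
  init :: "'s set"
  props :: "'p set"
  label :: "'s \<Rightarrow> 'p set"

definition wf_labelled_states :: "('s, 'p, 'z) labelled_states_scheme \<Rightarrow> bool" where
  "wf_labelled_states M \<longleftrightarrow> init M \<subseteq> states M \<and> (\<forall>s\<in>states M. label M s \<subseteq> props M)"


section \<open>Discrete-time Markov processes\<close>

record ('s, 'p) dtmp = "('s, 'p) labelled_states" +
  prob :: "'s \<Rightarrow> 's \<Rightarrow> real"

definition is_dtmp :: "('s, 'p) dtmp \<Rightarrow> bool" where
  "is_dtmp D \<longleftrightarrow> wf_labelled_states D \<and>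
     (\<forall>s\<in>states D.
        (\<forall>s'\<in>states D. prob D s s' \<in> {0..1}) \<and>
        finite {s'\<in>states D. prob D s s' > 0} \<and>
        (\<Sum>s' | s' \<in> states D \<and> prob D s s' > 0. prob D s s') = 1)"

definition dtmp_step :: "('s, 'p) dtmp \<Rightarrow> 's \<Rightarrow> 's list \<Rightarrow> 's \<Rightarrow> real" where
  "dtmp_step D s h s' = (if h = [] then indicator {s} s' else prob D (last h) s')"

definition dtmp_paths :: "('s, 'p) dtmp \<Rightarrow> 's \<Rightarrow> (nat \<Rightarrow> 's) measure" where
  "dtmp_paths D s = path_measure (states D) (dtmp_step D s)"

definition dtmp_reach :: "('s, 'p) dtmp \<Rightarrow> 's \<Rightarrow> nat \<Rightarrow> 'p \<Rightarrow> ennreal" where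
  "dtmp_reach D s k b =
     emeasure (dtmp_paths D s) {\<omega>\<in>space (dtmp_paths D s). \<exists>i\<le>k. b \<in> label D (\<omega> i)}"


section \<open>Interval Markov decision processes\<close>

text \<open>
  Probability intervals are sets of reals, and the exact probability \<open>0\<close> is \<open>{0} = {0..0}\<close>.
  Which indices are available in a state is recorded explicitly in \<open>avail\<close>.
\<close>

record ('s, 'p) imdp = "('s, 'p) labelled_states" +
  avail :: "'s \<Rightarrow> nat set"
  iprob :: "'s \<Rightarrow> nat \<Rightarrow> 's \<Rightarrow> real set"

definition prob_intervals :: "real set set" where
  "prob_intervals = {{a..b} | a b. 0 < a \<and> a \<le> b \<and> b \<le> 1}"

definition is_imdp :: "('s, 'p) imdp \<Rightarrow> bool" where
  "is_imdp M \<longleftrightarrow> wf_labelled_states M \<and> finite (states M) \<and>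
     (\<forall>s\<in>states M. \<forall>j. \<forall>s'\<in>states M. iprob M s j s' \<in> prob_intervals \<union> {{0}})"

text \<open>
  A path \<open>s\<^sub>0 j\<^sub>0 s\<^sub>1 j\<^sub>1 \<dots>\<close> is a sequence of pairs of a state and the index chosen in it. The history
  \<open>s\<^sub>0 j\<^sub>0 \<dots> s\<^sub>n\<close> is split into the list of the first \<open>n\<close> pairs and the current state \<open>s\<^sub>n\<close>.
\<close>

definition choices :: "('s, 'p) imdp \<Rightarrow> ('s \<times> nat) set" where
  "choices M = (SIGMA s:states M. avail M s)"

type_synonym 's policy = "('s \<times> nat) list \<Rightarrow> 's \<Rightarrow> nat"
type_synonym 's env_policy = "('s \<times> nat) list \<Rightarrow> 's \<Rightarrow> nat \<Rightarrow> 's pmf"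

definition policies :: "('s, 'p) imdp \<Rightarrow> 's policy set" where
  "policies M = {\<sigma>. \<forall>h\<in>lists (choices M). \<forall>s\<in>states M. \<sigma> h s \<in> avail M s}"

definition env_policies :: "('s, 'p) imdp \<Rightarrow> 's env_policy set" where
  "env_policies M = {\<tau>. \<forall>h\<in>lists (choices M). \<forall>s\<in>states M. \<forall>j\<in>avail M s.
     set_pmf (\<tau> h s j) \<subseteq> states M \<and> (\<forall>s'\<in>states M. pmf (\<tau> h s j) s' \<in> iprob M s j s')}"

definition imdp_step ::
  "'s policy \<Rightarrow> 's env_policy \<Rightarrow> 's \<Rightarrow> ('s \<times> nat) list \<Rightarrow> ('s \<times> nat) pmf" where
  "imdp_step \<sigma> \<tau> s h =
     map_pmf (\<lambda>s'. (s', \<sigma> h s'))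
       (if h = [] then return_pmf s else \<tau> (butlast h) (fst (last h)) (snd (last h)))"

definition imdp_paths ::
  "('s, 'p) imdp \<Rightarrow> 's policy \<Rightarrow> 's env_policy \<Rightarrow> 's \<Rightarrow> (nat \<Rightarrow> 's \<times> nat) measure" where
  "imdp_paths M \<sigma> \<tau> s = path_measure (choices M) (\<lambda>h. pmf (imdp_step \<sigma> \<tau> s h))"

definition imdp_reach ::
  "('s, 'p) imdp \<Rightarrow> 's policy \<Rightarrow> 's env_policy \<Rightarrow> 's \<Rightarrow> nat \<Rightarrow> 'p \<Rightarrow> ennreal" where
  "imdp_reach M \<sigma> \<tau> s k b =
     emeasure (imdp_paths M \<sigma> \<tau> s)
       {\<omega>\<in>space (imdp_paths M \<sigma> \<tau> s). \<exists>i\<le>k. b \<in> label M (fst (\<omega> i))}"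

definition imdp_maxmax_reach :: "('s, 'p) imdp \<Rightarrow> 's \<Rightarrow> nat \<Rightarrow> 'p \<Rightarrow> ennreal" where
  "imdp_maxmax_reach M s k b = (SUP \<sigma>\<in>policies M. SUP \<tau>\<in>env_policies M. imdp_reach M \<sigma> \<tau> s k b)"


section \<open>RL execution models and their abstractions\<close>

datatype rl_prop = Fail

definition rl_setting ::
  "'s set \<Rightarrow> 'a set \<Rightarrow> ('s \<Rightarrow> 'a \<Rightarrow> 's) \<Rightarrow> ('s \<Rightarrow> 'a pmf) \<Rightarrow> 's set \<Rightarrow> 's set \<Rightarrow> bool" where
  "rl_setting S A E \<pi> S0 Sfail \<longleftrightarrow>
     finite A \<and> (\<forall>s\<in>S. \<forall>a\<in>A. E s a \<in> S) \<and> (\<forall>s\<in>S. set_pmf (\<pi> s) \<subseteq> A) \<and> S0 \<subseteq> S \<and> Sfail \<subseteq> S"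

definition rl_execution_model ::
  "'s set \<Rightarrow> 'a set \<Rightarrow> ('s \<Rightarrow> 'a \<Rightarrow> 's) \<Rightarrow> ('s \<Rightarrow> 'a pmf) \<Rightarrow> 's set \<Rightarrow> 's set \<Rightarrow> ('s, rl_prop) dtmp" where
  "rl_execution_model S A E \<pi> S0 Sfail =
     \<lparr> states = S, init = S0, props = {Fail},
       label = (\<lambda>s. if s \<in> Sfail then {Fail} else {}),
       prob = (\<lambda>s s'. \<Sum>a | a \<in> A \<and> E s a = s'. pmf (\<pi> s) a) \<rparr>"

definition env_abstraction ::
  "'a set \<Rightarrow> ('s \<Rightarrow> 'a \<Rightarrow> 's) \<Rightarrow> 's set set \<Rightarrow> ('s set \<Rightarrow> 'a \<Rightarrow> 's set) \<Rightarrow> bool" where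
  "env_abstraction A E S\<^sub>A E\<^sub>A \<longleftrightarrow>
     (\<forall>u\<in>S\<^sub>A. \<forall>a\<in>A. E\<^sub>A u a \<in> S\<^sub>A) \<and> (\<forall>u\<in>S\<^sub>A. \<forall>s\<in>u. \<forall>a\<in>A. E s a \<in> E\<^sub>A u a)"

definition policy_abstraction ::
  "'a set \<Rightarrow> ('s \<Rightarrow> 'a pmf) \<Rightarrow> 's set set \<Rightarrow> ('s set \<Rightarrow> 'a \<Rightarrow> real) \<Rightarrow> ('s set \<Rightarrow> 'a \<Rightarrow> real) \<Rightarrow> bool" where
  "policy_abstraction A \<pi> S\<^sub>A \<pi>\<^sub>L \<pi>\<^sub>U \<longleftrightarrow>
     (\<forall>u\<in>S\<^sub>A. \<forall>a\<in>A. \<pi>\<^sub>L u a \<in> {0..1} \<and> \<pi>\<^sub>U u a \<in> {0..1}) \<and>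
     (\<forall>u\<in>S\<^sub>A. \<forall>s\<in>u. \<forall>a\<in>A. \<pi>\<^sub>L u a \<le> pmf (\<pi> s) a \<and> pmf (\<pi> s) a \<le> \<pi>\<^sub>U u a)"

definition rl_execution_abstraction ::
  "('s, rl_prop) dtmp \<Rightarrow> 'a set \<Rightarrow> 's set set \<Rightarrow> ('s set \<Rightarrow> 'a \<Rightarrow> 's set) \<Rightarrow>
   ('s set \<Rightarrow> 'a \<Rightarrow> real) \<Rightarrow> ('s set \<Rightarrow> 'a \<Rightarrow> real) \<Rightarrow> ('s set, rl_prop) imdp \<Rightarrow> bool" where
  "rl_execution_abstraction D A S\<^sub>A E\<^sub>A \<pi>\<^sub>L \<pi>\<^sub>U M \<longleftrightarrow>
     is_imdp M \<and> states M = S\<^sub>A \<and>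
     (\<forall>s\<in>init D. \<exists>u\<in>init M. s \<in> u) \<and>
     (\<forall>u\<in>S\<^sub>A. \<exists>m v.
        v ` {1..m} \<subseteq> S\<^sub>A \<and> inj_on v {1..m} \<and> partition_on u (v ` {1..m}) \<and>
        avail M u = {1..m} \<and>
        (\<forall>j\<in>{1..m}. \<forall>u'\<in>S\<^sub>A.
           iprob M u j u' = {\<Sum>a | a \<in> A \<and> E\<^sub>A (v j) a = u'. \<pi>\<^sub>L (v j) a ..
                             \<Sum>a | a \<in> A \<and> E\<^sub>A (v j) a = u'. \<pi>\<^sub>U (v j) a})) \<and>
     props M = {Fail} \<and>
     (\<forall>u\<in>S\<^sub>A. Fail \<in> label M u \<longleftrightarrow> (\<exists>s\<in>u. Fail \<in> label D s))"


section \<open>Well-definedness\<close>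

lemma rl_execution_model_is_dtmp:
  assumes "rl_setting S A E \<pi> S0 Sfail"
  shows "is_dtmp (rl_execution_model S A E \<pi> S0 Sfail)"
proof -
  have A: "finite A" and E: "\<And>s a. s \<in> S \<Longrightarrow> a \<in> A \<Longrightarrow> E s a \<in> S"
    and \<pi>: "\<And>s. s \<in> S \<Longrightarrow> set_pmf (\<pi> s) \<subseteq> A" and S0: "S0 \<subseteq> S"
    using assms by (auto simp: rl_setting_def)
  define q where "q s s' = (\<Sum>a | a \<in> A \<and> E s a = s'. pmf (\<pi> s) a)" for s s'
  have q0: "q s s' \<ge> 0" for s s'
    by (auto simp: q_def intro: sum_nonneg)
  have supp: "{s'\<in>S. q s s' > 0} \<subseteq> E s ` A" for s
  proof
    fix s' assume "s' \<in> {s'\<in>S. q s s' > 0}"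
    then have "{a. a \<in> A \<and> E s a = s'} \<noteq> {}"
      unfolding q_def by (metis (lifting) mem_Collect_eq less_irrefl sum.empty)
    then show "s' \<in> E s ` A" by auto
  qed
  have tot: "(\<Sum>s' | s' \<in> S \<and> q s s' > 0. q s s') = 1" if "s \<in> S" for s
  proof -
    have "(\<Sum>s' | s' \<in> S \<and> q s s' > 0. q s s') = (\<Sum>s'\<in>E s ` A. q s s')"
      using A supp[of s] E[OF that] q0[of s]
      by (intro sum.mono_neutral_left) (auto simp: less_le)
    also have "\<dots> = (\<Sum>a\<in>A. pmf (\<pi> s) a)"
      unfolding q_def by (rule sum.image_gen[OF A, symmetric])
    also have "\<dots> = 1"
      using sum_pmf_eq_1[OF A \<pi>[OF that]] .
    finally show ?thesis .
  qed
  have fin: "finite {s'\<in>S. q s s' > 0}" for s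
    using supp A by (meson finite_imageI finite_subset)
  have le1: "q s s' \<le> 1" if "s \<in> S" "s' \<in> S" for s s'
  proof -
    have "q s s' \<le> (\<Sum>a\<in>A. pmf (\<pi> s) a)"
      unfolding q_def using A by (intro sum_mono2) auto
    then show ?thesis
      using sum_pmf_eq_1[OF A \<pi>[OF that(1)]] by simp
  qed
  show ?thesis
    using S0 q0 tot fin le1
    by (simp add: is_dtmp_def rl_execution_model_def wf_labelled_states_def flip: q_def)
qed

lemma prob_space_point_measureI:
  assumes "(\<integral>\<^sup>+x. f x \<partial>count_space X) = 1"
  shows "prob_space (point_measure X f)"
proof (rule prob_spaceI)
  have "(\<integral>\<^sup>+x. f x * indicator X x \<partial>count_space X) = (\<integral>\<^sup>+x. f x \<partial>count_space X)"
    by (intro nn_integral_cong) simp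
  then show "emeasure (point_measure X f) (space (point_measure X f)) = 1"
    using assms by (simp add: point_measure_def emeasure_density)
qed

lemma path_kernel_Ionescu_TulceaI:
  fixes X :: "'x set"
  assumes p: "\<And>h. h \<in> lists X \<Longrightarrow> (\<integral>\<^sup>+x. ennreal (p h x) \<partial>count_space X) = 1"
    and meas: "\<And>i. path_kernel X p i
      \<in> PiM {0..<i} (\<lambda>_. count_space X) \<rightarrow>\<^sub>M subprob_algebra (count_space X)"
  shows "Ionescu_Tulcea (path_kernel X p) (\<lambda>_. count_space X)"
proof (rule Ionescu_Tulcea.intro)
  fix i and \<omega> :: "nat \<Rightarrow> 'x"
  assume "\<omega> \<in> space (PiM {0..<i} (\<lambda>_. count_space X))"
  then have "map \<omega> [0..<i] \<in> lists X"
    by (auto simp: space_PiM)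
  then show "prob_space (path_kernel X p i \<omega>)"
    using p by (simp add: path_kernel_def prob_space_point_measureI)
qed (use meas in simp)

lemma path_kernel_in_subprob_algebra:
  assumes "h \<in> lists X" and "(\<integral>\<^sup>+x. ennreal (p h x) \<partial>count_space X) = 1"
  shows "point_measure X (\<lambda>x. ennreal (p h x)) \<in> space (subprob_algebra (count_space X))"
  using prob_space_point_measureI[OF assms(2)]
  by (simp add: space_subprob_algebra prob_space_imp_subprob_space sets_point_measure)

lemma dtmp_Ionescu_Tulcea:
  assumes D: "is_dtmp D" and s: "s \<in> states D"
  shows "Ionescu_Tulcea (path_kernel (states D) (dtmp_step D s)) (\<lambda>_. count_space (states D))"
proof (rule path_kernel_Ionescu_TulceaI)
  let ?X = "states D"
  have P: "(\<integral>\<^sup>+x. ennreal (prob D t x) \<partial>count_space ?X) = 1" if t: "t \<in> ?X" for t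
  proof -
    have fin: "finite {x\<in>?X. prob D t x > 0}"
      and one: "(\<Sum>x | x \<in> ?X \<and> prob D t x > 0. prob D t x) = 1"
      using D t by (auto simp: is_dtmp_def)
    have "(\<integral>\<^sup>+x. ennreal (prob D t x) \<partial>count_space ?X)
        = (\<Sum>x | x \<in> ?X \<and> prob D t x > 0. ennreal (prob D t x))"
      using fin by (subst nn_integral_count_space) (auto simp: conj_commute)
    also have "\<dots> = ennreal (\<Sum>x | x \<in> ?X \<and> prob D t x > 0. prob D t x)"
      by (rule sum_ennreal) auto
    finally show ?thesis by (simp add: one)
  qed
  have I: "(\<integral>\<^sup>+x. ennreal (indicator {s} x) \<partial>count_space ?X) = 1"
  proof -
    have "(\<integral>\<^sup>+x. ennreal (indicator {s} x) \<partial>count_space ?X)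
        = (\<integral>\<^sup>+x. indicator {s} x \<partial>count_space ?X)"
      by (intro nn_integral_cong) (simp split: split_indicator)
    also have "\<dots> = emeasure (count_space ?X) {s}"
      using s by (intro nn_integral_indicator) auto
    finally show ?thesis using s by simp
  qed
  show p: "(\<integral>\<^sup>+x. ennreal (dtmp_step D s h x) \<partial>count_space ?X) = 1" if "h \<in> lists ?X" for h
  proof (cases "h = []")
    case True
    then show ?thesis using I by (simp add: dtmp_step_def)
  next
    case False
    then have "last h \<in> ?X" using that last_in_set by auto
    then show ?thesis using P False by (simp add: dtmp_step_def)
  qed
  show "path_kernel ?X (dtmp_step D s) i
      \<in> PiM {0..<i} (\<lambda>_. count_space ?X) \<rightarrow>\<^sub>M subprob_algebra (count_space ?X)" for i
  proof (cases i)
    case 0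
    have "path_kernel ?X (dtmp_step D s) i
        = (\<lambda>_. point_measure ?X (\<lambda>x. ennreal (dtmp_step D s [] x)))"
      by (simp add: path_kernel_def 0)
    then show ?thesis
      using path_kernel_in_subprob_algebra[of "[]" ?X "dtmp_step D s"] p[of "[]"] by simp
  next
    case (Suc n)
    let ?f = "\<lambda>t. point_measure ?X (\<lambda>x. ennreal (dtmp_step D s [t] x))"
    have "path_kernel ?X (dtmp_step D s) i = (\<lambda>\<omega>. ?f (\<omega> n))"
      by (simp add: path_kernel_def Suc dtmp_step_def)
    moreover have "?f \<in> count_space ?X \<rightarrow>\<^sub>M subprob_algebra (count_space ?X)"
      using path_kernel_in_subprob_algebra[of "[_]" ?X "dtmp_step D s"] p by auto
    moreover have "(\<lambda>\<omega>. \<omega> n) \<in> PiM {0..<i} (\<lambda>_. count_space ?X) \<rightarrow>\<^sub>M count_space ?X"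
      by (rule measurable_component_singleton) (simp add: Suc)
    ultimately show ?thesis
      using measurable_compose[of "\<lambda>\<omega>. \<omega> n" _ "count_space ?X" ?f] by simp
  qed
qed

lemma imdp_Ionescu_Tulcea:
  assumes M: "is_imdp M" and \<sigma>: "\<sigma> \<in> policies M" and \<tau>: "\<tau> \<in> env_policies M" and s: "s \<in> states M"
  shows "Ionescu_Tulcea (path_kernel (choices M) (\<lambda>h. pmf (imdp_step \<sigma> \<tau> s h)))
           (\<lambda>_. count_space (choices M))"
proof (rule path_kernel_Ionescu_TulceaI)
  let ?X = "choices M" and ?p = "\<lambda>h. pmf (imdp_step \<sigma> \<tau> s h)"
  have "countable ?X"
    using M by (auto simp: is_imdp_def choices_def intro: countable_finite)
  show p: "(\<integral>\<^sup>+x. ennreal (?p h x) \<partial>count_space ?X) = 1" if h: "h \<in> lists ?X" for h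
  proof -
    have "set_pmf (if h = [] then return_pmf s else \<tau> (butlast h) (fst (last h)) (snd (last h)))
        \<subseteq> states M"
    proof (cases "h = []")
      case False
      then have "last h \<in> ?X" "butlast h \<in> lists ?X"
        using h last_in_set[OF False] by (auto simp: in_lists_conv_set dest: in_set_butlastD)
      moreover from this have "fst (last h) \<in> states M" "snd (last h) \<in> avail M (fst (last h))"
        by (auto simp: choices_def)
      ultimately show ?thesis using \<tau> False by (simp add: env_policies_def)
    qed (use s in simp)
    then have "set_pmf (imdp_step \<sigma> \<tau> s h) \<subseteq> ?X"
      using \<sigma> h unfolding imdp_step_def set_map_pmf policies_def
      by (fastforce simp: choices_def)
    then have "emeasure (measure_pmf (imdp_step \<sigma> \<tau> s h)) ?X = 1"
      by (intro measure_pmf.emeasure_eq_1_AE) (auto simp: AE_measure_pmf_iff)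
    then show ?thesis
      by (simp add: nn_integral_pmf)
  qed
  show "path_kernel ?X ?p i
      \<in> PiM {0..<i} (\<lambda>_. count_space ?X) \<rightarrow>\<^sub>M subprob_algebra (count_space ?X)" for i
  proof -
    have "map \<omega> [0..<i] \<in> lists ?X" if "\<omega> \<in> PiE {0..<i} (\<lambda>_. ?X)" for \<omega>
      using PiE_mem[OF that] by (auto simp: in_lists_conv_set)
    then show ?thesis
      using \<open>countable ?X\<close> path_kernel_in_subprob_algebra[of _ ?X ?p] p
      by (simp add: count_space_PiM_finite path_kernel_def)
  qed
qed

end

theory Submission
  imports Defs
begin

text \<open>
  The IMDP can simulate the Markov process. Along an abstract history one keeps track of a concrete
  state \<open>t\<close> lying in the current abstract state: the policy picks the index of the cell containing
  \<open>t\<close>, and the environment resolves the intervals by the push-forward of \<open>\<pi> t\<close> along the abstract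
  environment. Several actions may lead to the same abstract successor but to different concrete
  ones; the tracked successor is the one, among these finitely many, with the largest probability
  of failing within the remaining steps. By induction on the remaining steps, avoiding failure is
  at most as likely in the IMDP as in the Markov process, because an abstract state without label
  \<open>Fail\<close> contains no failure state.
\<close>

section \<open>Avoidance probabilities of history-dependent processes\<close>

text \<open>Only the \<open>n\<close> elements following the history \<open>h\<close> have to lie outside \<open>B\<close>, not those of \<open>h\<close>.\<close>

primrec avoid :: "('x list \<Rightarrow> 'x pmf) \<Rightarrow> 'x set \<Rightarrow> nat \<Rightarrow> 'x list \<Rightarrow> ennreal" where
  "avoid q B 0 h = 1"
| "avoid q B (Suc n) h = (\<integral>\<^sup>+x. indicator (- B) x * avoid q B n (h @ [x]) \<partial>measure_pmf (q h))"

lemma nn_integral_path_kernel: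
  assumes "set_pmf Q \<subseteq> X" and "\<And>x. x \<in> X \<Longrightarrow> p (map \<omega> [0..<i]) x = pmf Q x"
  shows "(\<integral>\<^sup>+x. f x \<partial>path_kernel X p i \<omega>) = (\<integral>\<^sup>+x. f x \<partial>measure_pmf Q)"
proof -
  have "(\<integral>\<^sup>+x. f x \<partial>path_kernel X p i \<omega>) = (\<integral>\<^sup>+x. ennreal (pmf Q x) * f x \<partial>count_space X)"
    unfolding path_kernel_def point_measure_def
    using assms(2) by (subst nn_integral_density) (auto intro!: nn_integral_cong)
  also have "\<dots> = (\<integral>\<^sup>+x. ennreal (pmf Q x) * f x \<partial>count_space UNIV)"
    using assms(1) by (intro nn_integral_count_space_eq) (auto simp: set_pmf_iff)
  finally show ?thesis
    by (simp add: nn_integral_measure_pmf)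
qed

text \<open>The complement of the event is a cylinder over the first \<open>Suc k\<close>
  coordinates; its measure is an iterated kernel integral, and integrating out the last coordinate
  repeatedly yields \<open>avoid\<close>. Measurability is a hypothesis because, for uncountable
  \<open>X\<close>, a function of several coordinates need not be measurable for the product of
  discrete sigma-algebras.\<close>

lemma emeasure_path_measure_reach:
  fixes X :: "'x set"
  assumes IT: "Ionescu_Tulcea (path_kernel X p) (\<lambda>_. count_space X)"
    and q: "\<And>h. h \<in> lists X \<Longrightarrow> set_pmf (q h) \<subseteq> X"
    and pq: "\<And>h x. h \<in> lists X \<Longrightarrow> x \<in> X \<Longrightarrow> p h x = pmf (q h) x"
    and meas: "\<And>n m. (\<lambda>\<omega>. avoid q B n (map \<omega> [0..<m])) \<in> borel_measurable (PiM {0..<m} (\<lambda>_. count_space X))"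
  shows "emeasure (path_measure X p) {\<omega>\<in>space (path_measure X p). \<exists>i\<le>k. \<omega> i \<in> B}
    = 1 - avoid q B (Suc k) []"
proof -
  interpret Ionescu_Tulcea "path_kernel X p" "\<lambda>_. count_space X" by (rule IT)
  interpret L: prob_space "path_measure X p"
    unfolding path_measure_def
  proof (rule prob_spaceI)
    \<comment> \<open>The whole space is the cylinder over the empty index set, so
      \<open>lim\<close> gives total mass one.\<close>
    have "emeasure PF.lim (PF.emb UNIV {} (space (PiM {} (\<lambda>_. count_space X))))
        = emeasure (CI {}) (space (PiM {} (\<lambda>_. count_space X)))"
      by (rule lim) auto
    moreover have "PF.emb UNIV {} (space (PiM {} (\<lambda>_. count_space X))) = space PF.lim"
      by (auto simp: prod_emb_def space_PiM)
    ultimately show "emeasure PF.lim (space PF.lim) = 1"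
      using prob_space.emeasure_space_1[OF PF.prob_space_P[of "{}"]] by (simp add: PF.space_P)
  qed
  define J where "J m = {\<omega> :: nat \<Rightarrow> 'x. \<forall>i<m. \<omega> i \<notin> B}" for m
  have J_sets: "J m \<inter> space (PiM I (\<lambda>_. count_space X)) \<in> sets (PiM I (\<lambda>_. count_space X))"
    if "{0..<m} \<subseteq> I" for m I
  proof -
    have "{\<omega>\<in>space (PiM I (\<lambda>_. count_space X)). \<forall>i\<in>{0..<m}. \<omega> i \<in> X - B}
        \<in> sets (PiM I (\<lambda>_. count_space X))"
    proof (rule sets.sets_Collect_finite_All)
      fix i assume "i \<in> {0..<m}"
      then have "(\<lambda>\<omega>. \<omega> i) -` (X - B) \<inter> space (PiM I (\<lambda>_. count_space X))
          \<in> sets (PiM I (\<lambda>_. count_space X))"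
        using that by (intro measurable_sets[OF measurable_component_singleton]) auto
      then show "{\<omega> \<in> space (PiM I (\<lambda>_. count_space X)). \<omega> i \<in> X - B}
          \<in> sets (PiM I (\<lambda>_. count_space X))"
        by (simp add: vimage_def Int_def conj_commute)
    qed simp
    moreover have "{\<omega>\<in>space (PiM I (\<lambda>_. count_space X)). \<forall>i\<in>{0..<m}. \<omega> i \<in> X - B}
        = J m \<inter> space (PiM I (\<lambda>_. count_space X))"
      using that by (auto simp: J_def space_PiM PiE_iff extensional_def)
    ultimately show ?thesis by simp
  qed
  have J_meas: "(indicator (J m) :: _ \<Rightarrow> ennreal) \<in> borel_measurable (PiM {0..<m} (\<lambda>_. count_space X))" for m
    using J_sets[of m "{0..<m}"] by (simp add: borel_measurable_indicator_iff)
  have start: "(\<lambda>_. undefined) \<in> space (PiM {0..<0::nat} (\<lambda>_. count_space X))"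
    by simp
  \<comment> \<open>\<open>m\<close> entries are already sampled by \<open>C\<close>, starting from
    the only element of the empty product, and \<open>n\<close> are left to \<open>avoid\<close>.
    Each induction step moves one entry from the former to the latter, so \<open>n\<close> must
    vary.\<close>
  have C: "(\<integral>\<^sup>+\<omega>. indicator (J m) \<omega> * avoid q B n (map \<omega> [0..<m]) \<partial>C 0 m (\<lambda>_. undefined))
      = avoid q B (m + n) []" for m n
  proof (induction m arbitrary: n)
    case 0
    then show ?case
      using meas[of n 0] start
      by (simp add: nn_integral_return J_def del: C.simps(2))
  next
    case (Suc m)
    let ?f = "\<lambda>m n \<omega>. indicator (J m) \<omega> * avoid q B n (map \<omega> [0..<m])"
    have f: "?f m n \<in> borel_measurable (PiM {0..<m} (\<lambda>_. count_space X))" for m n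
      using J_meas meas by simp
    have "(\<integral>\<^sup>+\<omega>. ?f (Suc m) n \<omega> \<partial>C 0 (Suc m) (\<lambda>_. undefined))
        = (\<integral>\<^sup>+\<omega>. \<integral>\<^sup>+\<omega>'. ?f (Suc m) n \<omega>' \<partial>eP m \<omega> \<partial>C 0 m (\<lambda>_. undefined))"
      unfolding C.simps
      by (subst nn_integral_bind[where B="PiM {0..<Suc m} (\<lambda>_. count_space X)"])
        (use f[of "Suc m" n] start measurable_eP[of m] sets_C[OF start, of m] in
          \<open>auto simp del: upt_Suc cong: measurable_cong_sets\<close>)
    also have "\<dots> = (\<integral>\<^sup>+\<omega>. ?f m (Suc n) \<omega> \<partial>C 0 m (\<lambda>_. undefined))"
    proof (rule nn_integral_cong)
      fix \<omega> assume "\<omega> \<in> space (C 0 m (\<lambda>_. undefined))"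
      then have \<omega>: "\<omega> \<in> space (PiM {0..<m} (\<lambda>_. count_space X))"
        using space_C[OF start, of m] by simp
      then have h: "map \<omega> [0..<m] \<in> lists X"
        by (auto simp: space_PiM)
      \<comment> \<open>\<open>eP m\<close> extends \<open>\<omega>\<close> by coordinate
        \<open>m\<close>; the new indicator factor is the one in the recursion of
        \<open>avoid\<close>.\<close>
      have *: "?f (Suc m) n (fun_upd \<omega> m x)
          = indicator (J m) \<omega> * (indicator (- B) x * avoid q B n (map \<omega> [0..<m] @ [x]))" for x
      proof -
        have "map (fun_upd \<omega> m x) [0..<Suc m] = map \<omega> [0..<m] @ [x]" by simp
        moreover have "fun_upd \<omega> m x \<in> J (Suc m) \<longleftrightarrow> \<omega> \<in> J m \<and> x \<notin> B"
          by (auto simp: J_def less_Suc_eq)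
        ultimately show ?thesis by (auto split: split_indicator)
      qed
      show "(\<integral>\<^sup>+\<omega>'. ?f (Suc m) n \<omega>' \<partial>eP m \<omega>) = ?f m (Suc n) \<omega>"
        unfolding nn_integral_eP[OF \<omega> f] *
        using nn_integral_path_kernel[where p=p and \<omega>=\<omega> and i=m, OF q[OF h] pq[OF h]]
        by (simp add: nn_integral_cmult)
    qed
    finally show ?case
      using Suc.IH[of "Suc n"] by simp
  qed
  \<comment> \<open>Positions \<open>0\<close> to \<open>k\<close> make \<open>Suc k\<close>
    coordinates, all sampled by \<open>C\<close>; so the claim \<open>C\<close> is used with
    \<open>n = 0\<close>.\<close>
  let ?m = "Suc k"
  let ?J = "J ?m \<inter> space (PiM {0..<?m} (\<lambda>_. count_space X))"
  let ?S = "{\<omega>\<in>space (path_measure X p). \<exists>i\<le>k. \<omega> i \<in> B}"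
  have emb: "space (path_measure X p) - ?S = PF.emb UNIV {0..<?m} ?J"
    by (auto simp: path_measure_def prod_emb_def space_PiM PiE_iff J_def less_Suc_eq_le)
  have J_k: "?J \<in> sets (PiM {0..<?m} (\<lambda>_. count_space X))"
    by (rule J_sets) simp
  have "emeasure (path_measure X p) (space (path_measure X p) - ?S) = emeasure (CI {0..<?m}) ?J"
    unfolding emb unfolding path_measure_def by (rule lim[OF _ J_k]) simp
  also have "\<dots> = emeasure (C 0 ?m (\<lambda>_. undefined)) ?J"
    \<comment> \<open>The index set is all of \<open>{0..<?m}\<close>, so the embedding in
      \<open>emeasure_CI\<close> is the identity.\<close>
    using emeasure_CI[OF _ J_k, of ?m] prod_emb_id[of ?J "{0..<?m}" "\<lambda>_. count_space X"]
    by (simp add: space_PiM del: C.simps)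
  also have "\<dots> = (\<integral>\<^sup>+\<omega>. indicator ?J \<omega> \<partial>C 0 ?m (\<lambda>_. undefined))"
    using J_k sets_C[OF start, of ?m] by (simp del: C.simps)
  also have "\<dots> = avoid q B ?m []"
  proof -
    have "(\<integral>\<^sup>+\<omega>. indicator ?J \<omega> \<partial>C 0 ?m (\<lambda>_. undefined))
        = (\<integral>\<^sup>+\<omega>. indicator (J ?m) \<omega> * avoid q B 0 (map \<omega> [0..<?m]) \<partial>C 0 ?m (\<lambda>_. undefined))"
      using space_C[OF start, of ?m]
      by (intro nn_integral_cong) (simp add: indicator_def del: C.simps)
    then show ?thesis
      using C[of ?m 0] by (simp del: C.simps avoid.simps)
  qed
  finally have *: "emeasure (path_measure X p) (space (path_measure X p) - ?S) = avoid q B ?m []" .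
  have sets: "space (path_measure X p) - ?S \<in> sets (path_measure X p)"
    unfolding emb unfolding path_measure_def using J_k by simp
  have "?S = space (path_measure X p) - (space (path_measure X p) - ?S)" by auto
  then have "emeasure (path_measure X p) ?S
      = emeasure (path_measure X p) (space (path_measure X p) - (space (path_measure X p) - ?S))"
    by (rule arg_cong)
  also have "\<dots> = 1 - avoid q B ?m []"
    unfolding emeasure_compl[OF sets L.emeasure_finite[folded infinity_ennreal_def]]
    by (simp only: * L.emeasure_space_1)
  finally show ?thesis .
qed

section \<open>The execution model as a Markov chain\<close>

text \<open>Reads the sums over actions with a common successor as push-forwards, so that both
  processes can be integrated over actions.\<close>

lemma pmf_map_eq_sum:
  assumes "finite A" and "set_pmf p \<subseteq> A"
  shows "pmf (map_pmf f p) y = (\<Sum>a | a \<in> A \<and> f a = y. pmf p a)"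
proof -
  have "pmf (map_pmf f p) y = measure (measure_pmf p) (f -` {y})"
    by (rule pmf_map)
  also have "\<dots> = measure (measure_pmf p) {a. a \<in> A \<and> f a = y}"
    using assms(2) by (intro measure_prob_cong_0) (auto simp: set_pmf_iff)
  also have "\<dots> = (\<Sum>a | a \<in> A \<and> f a = y. pmf p a)"
    using assms(1) by (intro measure_measure_pmf_finite) simp
  finally show ?thesis .
qed

text \<open>\<open>avoid\<close> with the history reduced to its last entry, which again is not
  itself tested. Depending on one coordinate only makes it measurable over an uncountable state
  space.\<close>

primrec markov_avoid :: "('x \<Rightarrow> 'x pmf) \<Rightarrow> 'x set \<Rightarrow> nat \<Rightarrow> 'x \<Rightarrow> ennreal" where
  "markov_avoid \<kappa> B 0 x = 1"
| "markov_avoid \<kappa> B (Suc n) x = (\<integral>\<^sup>+y. indicator (- B) y * markov_avoid \<kappa> B n y \<partial>measure_pmf (\<kappa> x))"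

lemma avoid_markov:
  assumes "\<And>h. h \<noteq> [] \<Longrightarrow> q h = \<kappa> (last h)" and "h \<noteq> []"
  shows "avoid q B n h = markov_avoid \<kappa> B n (last h)"
  using assms(2)
proof (induction n arbitrary: h)
  case (Suc n)
  have "avoid q B n (h @ [x]) = markov_avoid \<kappa> B n x" for x
    using Suc.IH[of "h @ [x]"] by simp
  then show ?case
    using assms(1) Suc.prems by simp
qed simp

text \<open>Testing position \<open>0\<close> gives the separate indicator factor;
  \<open>markov_avoid\<close> tests the \<open>k\<close> positions after \<open>s\<close>.\<close>

lemma dtmp_reach_rl_execution_model:
  assumes rl: "rl_setting S A E \<pi> S0 Sfail" and s: "s \<in> S"
  defines "\<kappa> \<equiv> \<lambda>t. map_pmf (E t) (\<pi> t)"
  shows "dtmp_reach (rl_execution_model S A E \<pi> S0 Sfail) s k Fail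
    = 1 - indicator (- Sfail) s * markov_avoid \<kappa> Sfail k s"
proof -
  let ?D = "rl_execution_model S A E \<pi> S0 Sfail"
  \<comment> \<open>The start is a Dirac step after the empty history, so position \<open>0\<close>
    is drawn like all others.\<close>
  define q where "q h = (if h = [] then return_pmf s else \<kappa> (last h))" for h
  have A: "finite A" and E: "\<And>s a. s \<in> S \<Longrightarrow> a \<in> A \<Longrightarrow> E s a \<in> S"
    and \<pi>: "\<And>s. s \<in> S \<Longrightarrow> set_pmf (\<pi> s) \<subseteq> A"
    using rl by (auto simp: rl_setting_def)
  have D: "states ?D = S" "label ?D t = (if t \<in> Sfail then {Fail} else {})"
    "prob ?D t t' = (\<Sum>a | a \<in> A \<and> E t a = t'. pmf (\<pi> t) a)" for t t'
    by (simp_all add: rl_execution_model_def)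
  have av: "avoid q B n h = markov_avoid \<kappa> B n (last h)" if "h \<noteq> []" for B n h
    using that by (intro avoid_markov) (simp_all add: q_def)
  have last: "last h \<in> S" if "h \<in> lists S" "h \<noteq> []" for h
    using that last_in_set by auto
  have "emeasure (path_measure S (dtmp_step ?D s))
      {\<omega>\<in>space (path_measure S (dtmp_step ?D s)). \<exists>i\<le>k. \<omega> i \<in> Sfail} = 1 - avoid q Sfail (Suc k) []"
  proof (rule emeasure_path_measure_reach)
    show "Ionescu_Tulcea (path_kernel S (dtmp_step ?D s)) (\<lambda>_. count_space S)"
      using dtmp_Ionescu_Tulcea[OF rl_execution_model_is_dtmp[OF rl], of s] s by (simp only: D(1))
    fix h assume h: "h \<in> lists S"
    show "set_pmf (q h) \<subseteq> S"
    proof (cases "h = []")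
      case False
      then have "E (last h) ` set_pmf (\<pi> (last h)) \<subseteq> S"
        using E[OF last[OF h]] \<pi>[OF last[OF h]] by blast
      then show ?thesis
        using False by (simp add: q_def \<kappa>_def)
    qed (use s in \<open>simp add: q_def\<close>)
    show "dtmp_step ?D s h x = pmf (q h) x" for x
    proof (cases "h = []")
      case False
      then show ?thesis
        using pmf_map_eq_sum[OF A \<pi>[OF last[OF h False]], of "E (last h)" x]
        by (simp add: dtmp_step_def D(3) q_def \<kappa>_def)
    qed (auto simp: dtmp_step_def q_def split: split_indicator)
  next
    fix n m
    show "(\<lambda>\<omega>. avoid q Sfail n (map \<omega> [0..<m])) \<in> borel_measurable (PiM {0..<m} (\<lambda>_. count_space S))"
    \<comment> \<open>For positive \<open>m\<close> only the last coordinate matters, and every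
      function on \<open>count_space S\<close> is measurable; for \<open>m = 0\<close> the function
      is constant.\<close>
    proof (cases m)
      case (Suc l)
      have "(\<lambda>\<omega>. \<omega> l) \<in> PiM {0..<m} (\<lambda>_. count_space S) \<rightarrow>\<^sub>M count_space S"
        by (rule measurable_component_singleton) (simp add: Suc)
      then have "(\<lambda>\<omega>. markov_avoid \<kappa> Sfail n (\<omega> l)) \<in> borel_measurable (PiM {0..<m} (\<lambda>_. count_space S))"
        by (rule measurable_compose) simp
      moreover have "avoid q Sfail n (map \<omega> [0..<m]) = markov_avoid \<kappa> Sfail n (\<omega> l)" for \<omega>
        by (simp add: av Suc)
      ultimately show ?thesis by simp
    qed simp
  qed
  moreover have "avoid q Sfail (Suc k) [] = indicator (- Sfail) s * markov_avoid \<kappa> Sfail k s"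
    by (simp add: av) (simp add: q_def nn_integral_return_pmf)
  moreover have "Fail \<in> label ?D t \<longleftrightarrow> t \<in> Sfail" for t
    by (simp add: D)
  ultimately show ?thesis
    by (simp add: dtmp_reach_def dtmp_paths_def D(1) del: avoid.simps)
qed

section \<open>The interval Markov decision process under fixed policies\<close>

lemma set_pmf_imdp_step:
  assumes \<sigma>: "\<sigma> \<in> policies M" and \<tau>: "\<tau> \<in> env_policies M" and s: "s \<in> states M"
    and h: "h \<in> lists (choices M)"
  shows "set_pmf (imdp_step \<sigma> \<tau> s h) \<subseteq> choices M"
proof -
  have "set_pmf (if h = [] then return_pmf s else \<tau> (butlast h) (fst (last h)) (snd (last h)))
      \<subseteq> states M"
  proof (cases "h = []")
    case False
    then have "last h \<in> choices M" "butlast h \<in> lists (choices M)"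
      using h last_in_set[OF False] by (auto simp: in_lists_conv_set dest: in_set_butlastD)
    moreover from this have "fst (last h) \<in> states M" "snd (last h) \<in> avail M (fst (last h))"
      by (auto simp: choices_def)
    ultimately show ?thesis using \<tau> False by (simp add: env_policies_def)
  qed (use s in simp)
  then show ?thesis
    using \<sigma> h unfolding imdp_step_def set_map_pmf policies_def
    by (fastforce simp: choices_def)
qed

lemma imdp_reach_eq_avoid:
  assumes M: "is_imdp M" and \<sigma>: "\<sigma> \<in> policies M" and \<tau>: "\<tau> \<in> env_policies M" and s: "s \<in> states M"
  shows "imdp_reach M \<sigma> \<tau> s k b
    = 1 - avoid (imdp_step \<sigma> \<tau> s) {x. b \<in> label M (fst x)} (Suc k) []"
proof -
  \<comment> \<open>Finite products of a countable discrete space are discrete, so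
    \<open>avoid\<close> is measurable although it depends on the whole history.\<close>
  have "countable (choices M)"
    using M by (auto simp: is_imdp_def choices_def intro: countable_finite)
  then have "(\<lambda>\<omega>. avoid q B n (map \<omega> [0..<m]))
      \<in> borel_measurable (PiM {0..<m} (\<lambda>_. count_space (choices M)))" for q B n m
    by (simp add: count_space_PiM_finite)
  then show ?thesis
    using emeasure_path_measure_reach[OF imdp_Ionescu_Tulcea[OF assms] set_pmf_imdp_step[OF \<sigma> \<tau> s] refl,
        of "{x. b \<in> label M (fst x)}" k]
    by (simp add: imdp_reach_def imdp_paths_def del: avoid.simps)
qed

section \<open>Simulation of the execution model by the abstraction\<close>

text \<open>The list of past pairs is in reverse order, most recent first.\<close>

primrec track :: "(nat \<Rightarrow> 's \<Rightarrow> 'u \<times> nat \<Rightarrow> 'u \<Rightarrow> 's) \<Rightarrow> 's \<Rightarrow> ('u \<times> nat) list \<Rightarrow> 'u \<Rightarrow> 's" where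
  "track f s [] u = s"
| "track f s (y # ys) u = f (length ys) (track f s ys (fst y)) y u"

lemma imdp_reach_ge_dtmp_reach:
  fixes \<pi> :: "'s \<Rightarrow> 'a pmf"
  assumes rl: "rl_setting S A E \<pi> S0 Sfail"
    and S\<^sub>A: "S\<^sub>A \<subseteq> Pow S" "{} \<notin> S\<^sub>A"
    and env: "env_abstraction A E S\<^sub>A E\<^sub>A"
    and pol: "policy_abstraction A \<pi> S\<^sub>A \<pi>\<^sub>L \<pi>\<^sub>U"
    and abs: "rl_execution_abstraction (rl_execution_model S A E \<pi> S0 Sfail) A S\<^sub>A E\<^sub>A \<pi>\<^sub>L \<pi>\<^sub>U M"
    and s: "s \<in> S" "u \<in> S\<^sub>A" "s \<in> u"
  shows "\<exists>\<sigma>\<in>policies M. \<exists>\<tau>\<in>env_policies M.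
    dtmp_reach (rl_execution_model S A E \<pi> S0 Sfail) s k Fail \<le> imdp_reach M \<sigma> \<tau> u k Fail"
proof -
  have A: "finite A" and \<pi>: "\<And>t. t \<in> S \<Longrightarrow> set_pmf (\<pi> t) \<subseteq> A"
    using rl by (auto simp: rl_setting_def)
  have E\<^sub>A: "E\<^sub>A w a \<in> S\<^sub>A" if "w \<in> S\<^sub>A" "a \<in> A" for w a
    using env that by (auto simp: env_abstraction_def)
  have E: "E t a \<in> E\<^sub>A w a" if "w \<in> S\<^sub>A" "t \<in> w" "a \<in> A" for w t a
    using env that by (auto simp: env_abstraction_def)
  have M: "is_imdp M" "states M = S\<^sub>A"
    using abs by (auto simp: rl_execution_abstraction_def)
  have fail: "Fail \<in> label M w \<longleftrightarrow> w \<inter> Sfail \<noteq> {}" if "w \<in> S\<^sub>A" for w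
  proof -
    have "Fail \<in> label (rl_execution_model S A E \<pi> S0 Sfail) t \<longleftrightarrow> t \<in> Sfail" for t
      by (simp add: rl_execution_model_def)
    then show ?thesis
      using abs that by (auto simp: rl_execution_abstraction_def)
  qed
  \<comment> \<open>Indexing by \<open>avail M w\<close> removes the existential over
    \<open>m\<close>, so that one choice function \<open>v\<close> serves all abstract
    states.\<close>
  define cells where "cells w v \<longleftrightarrow> v ` avail M w \<subseteq> S\<^sub>A \<and> \<Union> (v ` avail M w) = w \<and>
      (\<forall>j\<in>avail M w. \<forall>w'\<in>S\<^sub>A. iprob M w j w' =
        {\<Sum>a | a \<in> A \<and> E\<^sub>A (v j) a = w'. \<pi>\<^sub>L (v j) a .. \<Sum>a | a \<in> A \<and> E\<^sub>A (v j) a = w'. \<pi>\<^sub>U (v j) a})"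
    for w v
  have "\<exists>v. cells w v" if "w \<in> S\<^sub>A" for w
  proof -
    have "\<exists>m v. v ` {1..m} \<subseteq> S\<^sub>A \<and> inj_on v {1..m} \<and> partition_on w (v ` {1..m}) \<and>
        avail M w = {1..m} \<and>
        (\<forall>j\<in>{1..m}. \<forall>w'\<in>S\<^sub>A. iprob M w j w' =
          {\<Sum>a | a \<in> A \<and> E\<^sub>A (v j) a = w'. \<pi>\<^sub>L (v j) a .. \<Sum>a | a \<in> A \<and> E\<^sub>A (v j) a = w'. \<pi>\<^sub>U (v j) a})"
      using abs that unfolding rl_execution_abstraction_def by blast
    then obtain m v where "v ` {1..m} \<subseteq> S\<^sub>A" "partition_on w (v ` {1..m})" "avail M w = {1..m}"
      "\<forall>j\<in>{1..m}. \<forall>w'\<in>S\<^sub>A. iprob M w j w' =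
        {\<Sum>a | a \<in> A \<and> E\<^sub>A (v j) a = w'. \<pi>\<^sub>L (v j) a .. \<Sum>a | a \<in> A \<and> E\<^sub>A (v j) a = w'. \<pi>\<^sub>U (v j) a}"
      by (elim exE conjE)
    then have "cells w v"
      by (simp add: cells_def partition_on_def)
    then show ?thesis by blast
  qed
  then obtain v where cells: "\<And>w. w \<in> S\<^sub>A \<Longrightarrow> cells w (v w)"
    by metis
  have v: "v w j \<in> S\<^sub>A" if "w \<in> S\<^sub>A" "j \<in> avail M w" for w j
    using cells[OF that(1)] that(2) by (auto simp: cells_def)
  have v_Un: "\<Union> (v w ` avail M w) = w" if "w \<in> S\<^sub>A" for w
    using cells[OF that] by (simp add: cells_def)
  have iprob: "iprob M w j w' =
        {\<Sum>a | a \<in> A \<and> E\<^sub>A (v w j) a = w'. \<pi>\<^sub>L (v w j) a ..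
         \<Sum>a | a \<in> A \<and> E\<^sub>A (v w j) a = w'. \<pi>\<^sub>U (v w j) a}"
    if "w \<in> S\<^sub>A" "j \<in> avail M w" "w' \<in> S\<^sub>A" for w j w'
    using cells[OF that(1)] that(2,3) by (simp add: cells_def)

  define \<kappa> where "\<kappa> t = map_pmf (E t) (\<pi> t)" for t
  define val where "val = markov_avoid \<kappa> Sfail"
  \<comment> \<open>Policies must be valid on all histories, so an available index is returned even
    when \<open>t\<close> lies outside \<open>w\<close>.\<close>
  define idx where "idx w t = (SOME j. j \<in> avail M w \<and> (t \<in> w \<longrightarrow> t \<in> v w j))" for w t
  \<comment> \<open>The environment must be admissible for every index, also one whose cell misses
    the tracked state; any state of the cell then serves, since the policy bounds hold
    there.\<close>
  define pt where "pt t C = (if t \<in> C then t else SOME t'. t' \<in> C)" for t :: 's and C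
  \<comment> \<open>\<open>i\<close> counts the steps before the current one, so \<open>k - Suc i\<close> steps remain after it.\<close>
  define best where "best i t y w =
    E t (arg_min_on (\<lambda>a. val (k - Suc i) (E t a)) {a \<in> A. E\<^sub>A (v (fst y) (snd y)) a = w})" for i t y w
  \<comment> \<open>The concrete state tracked in \<open>w\<close> after \<open>h\<close>; for the
    empty history it is \<open>s\<close>, whatever \<open>w\<close> is.\<close>
  define rep where "rep h w = track best s (rev h) w" for h w
  define \<sigma> where "\<sigma> h w = idx w (rep h w)" for h w
  define \<tau> where "\<tau> h w j = map_pmf (E\<^sub>A (v w j)) (\<pi> (pt (rep h w) (v w j)))" for h w j

  have idx: "idx w t \<in> avail M w \<and> (t \<in> w \<longrightarrow> t \<in> v w (idx w t))" if "w \<in> S\<^sub>A" for w t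
  proof -
    \<comment> \<open>A nonempty \<open>w\<close> is covered by its cells and hence has an available
      index, which settles the case \<open>t \<notin> w\<close>.\<close>
    have "w \<noteq> {}" using that S\<^sub>A by auto
    then have "\<exists>j. j \<in> avail M w \<and> (t \<in> w \<longrightarrow> t \<in> v w j)"
      using v_Un[OF that] by (cases "t \<in> w") blast+
    then show ?thesis unfolding idx_def by (rule someI_ex)
  qed
  have pt: "pt t C \<in> C" if "C \<in> S\<^sub>A" for t C
    using that S\<^sub>A some_in_eq[of C] by (auto simp: pt_def)
  have \<sigma>: "\<sigma> \<in> policies M"
    using idx by (simp add: policies_def M \<sigma>_def)
  have \<tau>: "\<tau> \<in> env_policies M"
    unfolding env_policies_def M(2)
  proof (intro CollectI ballI conjI)
    fix h w j assume w: "w \<in> S\<^sub>A" and j: "j \<in> avail M w"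
    let ?C = "v w j" and ?t = "pt (rep h w) (v w j)"
    have C: "?C \<in> S\<^sub>A" and t: "?t \<in> ?C"
      using v[OF w j] pt by auto
    then have supp: "set_pmf (\<pi> ?t) \<subseteq> A"
      using S\<^sub>A \<pi> by blast
    show "set_pmf (\<tau> h w j) \<subseteq> S\<^sub>A"
      using supp E\<^sub>A[OF C] by (auto simp: \<tau>_def)
    fix w' assume w': "w' \<in> S\<^sub>A"
    show "pmf (\<tau> h w j) w' \<in> iprob M w j w'"
      \<comment> \<open>The push-forward is a sum of \<open>\<pi>\<close> over actions, bounded
        termwise by the policy abstraction at \<open>?t \<in> ?C\<close>.\<close>
      unfolding iprob[OF w j w'] \<tau>_def pmf_map_eq_sum[OF A supp]
      using pol C t by (auto simp: policy_abstraction_def intro!: sum_mono)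
  qed

  let ?B = "{x. Fail \<in> label M (fst x)}" and ?q = "imdp_step \<sigma> \<tau> u"
  \<comment> \<open>The equation \<open>length g + n = k\<close> keeps the time in
    \<open>best\<close> in step with the remaining horizon: \<open>k - Suc (length g)\<close> is the
    \<open>n\<close> of the induction hypothesis.\<close>
  have main: "avoid ?q ?B n (g @ [(w, \<sigma> g w)]) \<le> val n (rep g w)"
    if "w \<in> S\<^sub>A" "rep g w \<in> w" "length g + n = k" for g w n
    using that
  proof (induction n arbitrary: g w)
    case 0
    then show ?case by (simp add: val_def)
  next
    case (Suc n)
    let ?t = "rep g w" and ?j = "\<sigma> g w"
    let ?C = "v w ?j" and ?h = "g @ [(w, ?j)]"
    have C: "?C \<in> S\<^sub>A" and t: "?t \<in> ?C"
      using idx[OF Suc.prems(1), of ?t] Suc.prems v by (auto simp: \<sigma>_def)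
    then have supp: "set_pmf (\<pi> ?t) \<subseteq> A"
      using S\<^sub>A \<pi> by blast
    \<comment> \<open>Since \<open>?t \<in> ?C\<close>, \<open>pt\<close> leaves \<open>?t\<close>
      unchanged. Both processes are thereby driven by the same random action and can be compared
      action by action.\<close>
    have step: "?q ?h = map_pmf (\<lambda>a. (E\<^sub>A ?C a, \<sigma> ?h (E\<^sub>A ?C a))) (\<pi> ?t)"
      using t by (simp add: imdp_step_def \<tau>_def pt_def map_pmf_comp)
    have "avoid ?q ?B (Suc n) ?h
        = (\<integral>\<^sup>+a. indicator (- ?B) (E\<^sub>A ?C a, \<sigma> ?h (E\<^sub>A ?C a)) *
             avoid ?q ?B n (?h @ [(E\<^sub>A ?C a, \<sigma> ?h (E\<^sub>A ?C a))]) \<partial>measure_pmf (\<pi> ?t))"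
      by (simp add: step)
    also have "\<dots> \<le> (\<integral>\<^sup>+a. indicator (- Sfail) (E ?t a) * val n (E ?t a) \<partial>measure_pmf (\<pi> ?t))"
    proof (rule nn_integral_mono_AE, rule AE_pmfI)
      fix a assume "a \<in> set_pmf (\<pi> ?t)"
      then have a: "a \<in> A" using supp by auto
      let ?w = "E\<^sub>A ?C a"
      have w: "?w \<in> S\<^sub>A" by (rule E\<^sub>A[OF C a])
      show "indicator (- ?B) (?w, \<sigma> ?h ?w) * avoid ?q ?B n (?h @ [(?w, \<sigma> ?h ?w)])
          \<le> indicator (- Sfail) (E ?t a) * val n (E ?t a)"
      \<comment> \<open>If the abstract successor is labelled \<open>Fail\<close>, the left side is
        zero; otherwise it contains no failure state and both indicators are one.\<close>
      proof (cases "Fail \<in> label M ?w")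
        case False
        then have safe: "E ?t a \<notin> Sfail"
          using fail[OF w] E[OF C t a] by auto
        let ?A = "{a' \<in> A. E\<^sub>A ?C a' = ?w}"
        \<comment> \<open>The action selected inside \<open>best\<close>. As \<open>a\<close> itself
          belongs to \<open>?A\<close>, the tracked successor avoids failure at most as likely as
          \<open>E ?t a\<close>.\<close>
        define a' where "a' = arg_min_on (\<lambda>a. val n (E ?t a)) ?A"
        have fin: "finite ?A" "?A \<noteq> {}"
          using A a by auto
        have a': "a' \<in> ?A"
          unfolding a'_def by (rule arg_min_if_finite(1)[OF fin])
        have le: "val n (E ?t a') \<le> val n (E ?t a)"
          unfolding a'_def by (rule arg_min_least[OF fin]) (use a in simp)
        have rep: "rep ?h ?w = E ?t a'"
        proof -
          have "k - Suc (length g) = n" using Suc.prems(3) by simp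
          then show ?thesis by (simp add: rep_def best_def a'_def)
        qed
        have "avoid ?q ?B n (?h @ [(?w, \<sigma> ?h ?w)]) \<le> val n (rep ?h ?w)"
          \<comment> \<open>\<open>a'\<close> leads to the same abstract state as \<open>a\<close>,
            so the environment abstraction puts the tracked successor into \<open>?w\<close>,
            restoring the invariant.\<close>
          using E[OF C t, of a'] a' Suc.prems(3) by (intro Suc.IH[OF w]) (auto simp: rep)
        also have "\<dots> \<le> val n (E ?t a)"
          using le by (simp add: rep)
        finally show ?thesis using safe False by simp
      qed simp
    qed
    also have "\<dots> = val (Suc n) ?t"
      by (simp add: val_def \<kappa>_def)
    finally show ?case .
  qed
  \<comment> \<open>Position \<open>0\<close> is tested here: if \<open>u\<close> is not labelled
    \<open>Fail\<close>, then \<open>s \<in> u\<close> is no failure state.\<close>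
  have "avoid ?q ?B (Suc k) [] = indicator (- ?B) (u, \<sigma> [] u) * avoid ?q ?B k [(u, \<sigma> [] u)]"
    by (simp add: imdp_step_def nn_integral_return_pmf)
  also have "\<dots> \<le> indicator (- Sfail) s * val k s"
    using main[of u "[]" k] s fail[OF s(2)] by (auto simp: rep_def split: split_indicator)
  \<comment> \<open>Passing to complements reverses the inequality between avoidance
    probabilities.\<close>
  finally have "dtmp_reach (rl_execution_model S A E \<pi> S0 Sfail) s k Fail \<le> imdp_reach M \<sigma> \<tau> u k Fail"
    unfolding dtmp_reach_rl_execution_model[OF rl s(1)] imdp_reach_eq_avoid[OF M(1) \<sigma> \<tau> s(2)[folded M(2)]]
    by (auto simp: val_def \<kappa>_def[abs_def] intro!: ennreal_minus_mono simp del: avoid.simps)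
  then show ?thesis using \<sigma> \<tau> by (intro bexI)
qed

theorem theorem1:
  fixes S :: "(real ^ 'n) set"
    and A :: "'a set"
    and E :: "real ^ 'n \<Rightarrow> 'a \<Rightarrow> real ^ 'n"
    and \<pi> :: "real ^ 'n \<Rightarrow> 'a pmf"
    and S0 Sfail :: "(real ^ 'n) set"
    and S\<^sub>A :: "(real ^ 'n) set set"
    and E\<^sub>A :: "(real ^ 'n) set \<Rightarrow> 'a \<Rightarrow> (real ^ 'n) set"
    and \<pi>\<^sub>L \<pi>\<^sub>U :: "(real ^ 'n) set \<Rightarrow> 'a \<Rightarrow> real"
    and M :: "((real ^ 'n) set, rl_prop) imdp"
    and k :: nat
    and s :: "real ^ 'n"
    and u :: "(real ^ 'n) set"
  assumes "rl_setting S A E \<pi> S0 Sfail"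
    and "S\<^sub>A \<subseteq> Pow S" and "{} \<notin> S\<^sub>A"
    and "env_abstraction A E S\<^sub>A E\<^sub>A"
    and "policy_abstraction A \<pi> S\<^sub>A \<pi>\<^sub>L \<pi>\<^sub>U"
    and "rl_execution_abstraction (rl_execution_model S A E \<pi> S0 Sfail) A S\<^sub>A E\<^sub>A \<pi>\<^sub>L \<pi>\<^sub>U M"
    and "s \<in> S" and "u \<in> S\<^sub>A" and "s \<in> u"
  shows "dtmp_reach (rl_execution_model S A E \<pi> S0 Sfail) s k Fail \<le> imdp_maxmax_reach M u k Fail"
proof -
  obtain \<sigma> \<tau> where \<sigma>: "\<sigma> \<in> policies M" and \<tau>: "\<tau> \<in> env_policies M"
    and le: "dtmp_reach (rl_execution_model S A E \<pi> S0 Sfail) s k Fail \<le> imdp_reach M \<sigma> \<tau> u k Fail"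
    using imdp_reach_ge_dtmp_reach[OF assms] by blast
  show ?thesis
    unfolding imdp_maxmax_reach_def by (rule SUP_upper2[OF \<sigma>], rule SUP_upper2[OF \<tau>], rule le)
qed

end
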